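(* Let $R=k[x_1,x_2,x_3]$ and let $(h_0,h_1,\ldots,h_s)$ be the $h$-vector of a graded Artinian algebra $A=R/I$ with socle degree $s$. If for some $d$ $$h_{d-1}>h_d\qquad\text{and}\qquad h_d=h_{d+1}\leq 2d+3,$$ then this $h$-vector is not level, i.e. there is no graded Artinian level algebra $R/J$ with this Hilbert function.
   Context: $k$ is an infinite field of characteristic $0$; $h_i=\dim_kA_i$, $A_s\ne0$. A graded Artinian algebra is level if its socle $\{a:a\mathfrak m=0\}$ ($\mathfrak m$ the maximal homogeneous ideal) is concentrated in a single degree; a Hilbert function is level if it is the Hilbert function of some graded Artinian level algebra. *)

theory Defs
  imports Main "HOL.Vector_Spaces" "HOL-Library.Function_Algebras"
begin

text \<open>Polynomials in R = k[x1,x2,x3], represented as coefficient functions on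
  exponent triples (a1,a2,a3) (the monomial x1^a1 x2^a2 x3^a3) with finite support.\<close>

type_synonym 'k poly3 = "nat \<times> nat \<times> nat \<Rightarrow> 'k"

definition deg3 :: "nat \<times> nat \<times> nat \<Rightarrow> nat" where
  "deg3 m = fst m + fst (snd m) + snd (snd m)"

definition Polys :: "'k::field poly3 set" where
  "Polys = {f. finite {m. f m \<noteq> 0}}"

definition pmult :: "'k::field poly3 \<Rightarrow> 'k poly3 \<Rightarrow> 'k poly3" where
  "pmult f g = (\<lambda>(m1, m2, m3). \<Sum>a1\<le>m1. \<Sum>a2\<le>m2. \<Sum>a3\<le>m3.
      f (a1, a2, a3) * g (m1 - a1, m2 - a2, m3 - a3))"

definition var :: "nat \<Rightarrow> 'k::field poly3" where
  "var j = (\<lambda>m. if m = (if j = 0 then (1,0,0) else if j = 1 then (0,1,0) else (0,0,1))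
                then 1 else 0)"

definition homog_comp :: "nat \<Rightarrow> 'k::field poly3 \<Rightarrow> 'k poly3" where
  "homog_comp i f = (\<lambda>m. if deg3 m = i then f m else 0)"

definition R_deg :: "nat \<Rightarrow> 'k::field poly3 set" where
  "R_deg i = {f. \<forall>m. f m \<noteq> 0 \<longrightarrow> deg3 m = i}"

definition homogeneous_ideal :: "'k::field poly3 set \<Rightarrow> bool" where
  "homogeneous_ideal I \<longleftrightarrow>
     I \<subseteq> Polys \<and> (\<lambda>_. 0) \<in> I \<and>
     (\<forall>f\<in>I. \<forall>g\<in>I. (\<lambda>m. f m + g m) \<in> I) \<and>
     (\<forall>f\<in>I. \<forall>g\<in>Polys. pmult g f \<in> I) \<and>
     (\<forall>f\<in>I. \<forall>i. homog_comp i f \<in> I)"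

definition kdim :: "'k::field poly3 set \<Rightarrow> nat" where
  "kdim V = vector_space.dim (\<lambda>c f. (\<lambda>m. c * f m)) V"

text \<open>Hilbert function of R/I: h_i = dim_k (R_i / I_i) = dim R_i - dim I_i.\<close>
definition hilb :: "'k::field poly3 set \<Rightarrow> nat \<Rightarrow> nat" where
  "hilb I i = kdim (R_deg i :: 'k poly3 set) - kdim (I \<inter> R_deg i)"

definition artinian :: "'k::field poly3 set \<Rightarrow> bool" where
  "artinian I \<longleftrightarrow> (\<exists>N. \<forall>i\<ge>N. R_deg i \<subseteq> I)"

text \<open>R/J is a graded Artinian level algebra: the socle {a. a m = 0} is contained
  in A_t for a single degree t.\<close>
definition level_ideal :: "'k::field poly3 set \<Rightarrow> bool" where
  "level_ideal J \<longleftrightarrow> homogeneous_ideal J \<and> artinian J \<and>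
     (\<exists>t. \<forall>f\<in>Polys. (\<forall>j<3. pmult (var j) f \<in> J) \<longrightarrow>
            (\<lambda>m. f m - homog_comp t f m) \<in> J)"

end

theory Submission
  imports Defs "HOL-Computational_Algebra.Polynomial"
begin

text \<open>Multiply by the linear forms \<open>l_t = x + t y + t\<^sup>2 z\<close>. Let \<open>c'\<close> and \<open>c\<close> be the dimensions of
  \<open>A / l_t A\<close> in degrees \<open>d\<close> and \<open>d + 1\<close>. The kernels of \<open>l_t\<close> in degrees \<open>d - 1\<close> and \<open>d\<close> have
  dimensions at least \<open>c' + 1\<close> and exactly \<open>c\<close>. They form a module over \<open>k[y, z]\<close>, and if there is no
  socle in these two degrees, then \<open>c' + 1 < 2 c\<close>. This forces \<open>c \<ge> 2\<close> for every \<open>t\<close>, whence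
  \<open>h_{d+1} \<ge> 2 d + 3\<close> by a form of Green's restriction theorem. So equality holds, \<open>c = 2\<close> for infinitely
  many \<open>t\<close>, and the extremality of \<open>I\<close> in degree \<open>d + 1\<close> makes the kernel of a suitable \<open>l_s\<close> in degree \<open>d\<close>
  consist of socle elements. In a level algebra there are none, as \<open>d\<close> is below the socle degree.\<close>

section \<open>Dimension counts in finite-dimensional subspaces\<close>

locale vec_space = vector_space scale
  for scale :: "'a::field \<Rightarrow> 'b::ab_group_add \<Rightarrow> 'b"
begin

text \<open>The ambient space of coefficient functions is infinite-dimensional, so finiteness is
  tracked per subset; without it \<open>dim\<close> is not monotone.\<close>

definition fin_dim :: "'b set \<Rightarrow> bool" where
  "fin_dim V \<longleftrightarrow> (\<exists>B. finite B \<and> V \<subseteq> span B)"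

lemma fin_dim_subset: "fin_dim W \<Longrightarrow> V \<subseteq> W \<Longrightarrow> fin_dim V"
  unfolding fin_dim_def by blast

lemma fin_dim_basis:
  assumes "fin_dim V" "subspace V"
  obtains B where "finite B" "independent B" "span B = V" "card B = dim V"
proof -
  obtain B where B: "B \<subseteq> V" "independent B" "V \<subseteq> span B" "card B = dim V"
    using basis_exists by blast
  obtain S where S: "finite S" "V \<subseteq> span S"
    using assms(1) unfolding fin_dim_def by blast
  have "finite B"
    using independent_span_bound[OF S(1) B(2)] B(1) S(2) by blast
  moreover have "span B = V"
    using B assms(2) by (simp add: span_subspace)
  ultimately show thesis using that B by blast
qed

lemma fin_dim_Un:
  assumes "fin_dim V" "fin_dim W"
  shows "fin_dim (span (V \<union> W))"
proof -
  obtain A B where "finite A" "V \<subseteq> span A" "finite B" "W \<subseteq> span B"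
    using assms unfolding fin_dim_def by blast
  moreover from this have "span (V \<union> W) \<subseteq> span (A \<union> B)"
    by (intro span_minimal) (auto intro: subsetD[OF span_mono])
  ultimately show ?thesis
    unfolding fin_dim_def by (intro exI[of _ "A \<union> B"]) auto
qed

lemma dim_mono_fin:
  assumes "fin_dim W" "V \<subseteq> W"
  shows "dim V \<le> dim W"
proof -
  have "fin_dim (span W)" using fin_dim_Un[OF assms(1,1)] by simp
  then obtain B where B: "finite B" "span B = span W" "card B = dim (span W)"
    using fin_dim_basis[of "span W"] by auto
  have "V \<subseteq> span B" using B(2) assms(2) span_superset by blast
  from dim_le_card[OF this B(1)] B(3) show ?thesis by simp
qed

lemma dim_insert_le:
  assumes "fin_dim V"
  shows "dim (insert z V) \<le> Suc (dim V)"
proof -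
  have "fin_dim (span V)" using fin_dim_Un[OF assms assms] by simp
  then obtain B where B: "finite B" "span B = span V" "card B = dim (span V)"
    using fin_dim_basis[of "span V"] by auto
  have "V \<subseteq> span (insert z B)"
    using span_superset[of V] B(2) span_mono[of B "insert z B"] by auto
  then have "insert z V \<subseteq> span (insert z B)" by (simp add: span_base)
  then have "dim (insert z V) \<le> card (insert z B)" using B(1) by (intro dim_le_card) auto
  also have "\<dots> \<le> Suc (card B)" by (simp add: B(1) card_insert_if)
  finally show ?thesis using B(3) by simp
qed

lemma subspace_eq_of_dim_le:
  assumes "fin_dim W" "subspace V" "subspace W" "V \<subseteq> W" "dim W \<le> dim V"
  shows "V = W"
proof (rule ccontr)
  assume "V \<noteq> W"
  with assms(4) obtain w where w: "w \<in> W" "w \<notin> V" by blast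
  obtain B where B: "finite B" "independent B" "span B = V" "card B = dim V"
    using fin_dim_basis assms(1,2,4) fin_dim_subset by metis
  have "independent (insert w B)" using w(2) B by (intro independent_insertI) auto
  moreover have "w \<notin> B" using w(2) B(3) span_base by blast
  ultimately have "dim (insert w B) = Suc (dim V)"
    using B(1,4) by (metis dim_eq_card_independent card_insert_disjoint)
  moreover have "insert w B \<subseteq> W" using B(3) assms(4) w(1) span_superset by blast
  ultimately show False using dim_mono_fin[OF assms(1), of "insert w B"] assms(5) by simp
qed

text \<open>Rank-nullity for \<open>P\<close> mapped to the sum modulo \<open>W\<close>. A basis
  \<open>C\<close> of the kernel extends to a basis \<open>B\<close> of \<open>P\<close>; the images
  of \<open>B - C\<close> and a basis of \<open>W\<close> together form a basis of the sum.\<close>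

lemma dim_image_sum_preimage:
  assumes lin: "Vector_Spaces.linear scale scale \<phi>" and inj: "inj \<phi>"
    and P: "fin_dim P" "subspace P" and W: "fin_dim W" "subspace W"
  shows "dim (span (\<phi> ` P \<union> W)) + dim {u \<in> P. \<phi> u \<in> W} = dim P + dim W"
proof -
  interpret f: Vector_Spaces.linear scale scale \<phi> by fact
  define K where "K = {u \<in> P. \<phi> u \<in> W}"
  have K: "subspace K" "K \<subseteq> P"
    using P(2) W(2) unfolding K_def subspace_def by (auto simp: f.add f.scale f.zero)
  obtain C where C: "finite C" "independent C" "span C = K" "card C = dim K"
    using fin_dim_basis K fin_dim_subset P(1) by metis
  obtain E where E: "finite E" "independent E" "span E = W" "card E = dim W"
    using fin_dim_basis W by metis
  have CP: "C \<subseteq> P" using C(3) K(2) span_superset by blast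
  obtain B where B: "C \<subseteq> B" "B \<subseteq> P" "independent B" "P \<subseteq> span B"
    using maximal_independent_subset_extend[OF CP C(2)] by metis
  obtain S where "finite S" "P \<subseteq> span S" using P(1) unfolding fin_dim_def by blast
  then have finB: "finite B" using independent_span_bound[OF _ B(3)] B(2) by blast
  have dimP: "card B = dim P" using basis_card_eq_dim B by blast
  have spB: "span B = P" using B P(2) by (simp add: span_subspace)
  define D where "D = B - C"
  have D: "finite D" "D \<inter> C = {}" "D \<union> C = B"
    using finB B(1) unfolding D_def by auto
  have "independent (\<phi> ` D' \<union> E) \<and> card (\<phi> ` D' \<union> E) = card D' + card E" if "D' \<subseteq> D" for D'
    using finite_subset[OF that D(1)] that
  proof (induction D' rule: finite_induct)
    case empty
    then show ?case using E by simp
  next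
    case (insert d D')
    \<comment> \<open>Otherwise \<open>d\<close> minus a combination of \<open>D'\<close> lies in
      \<open>K = span C\<close>, so \<open>d\<close> depends on \<open>B - {d}\<close>.\<close>
    have "\<phi> d \<notin> span (\<phi> ` D' \<union> E)"
    proof
      assume "\<phi> d \<in> span (\<phi> ` D' \<union> E)"
      then obtain x w where xw: "x \<in> span D'" "w \<in> W" "\<phi> d = \<phi> x + w"
        unfolding span_Un f.span_image E(3) by blast
      have dP: "d \<in> P" "D' \<subseteq> P" using insert.prems D(3) B(2) by auto
      have xP: "x \<in> P" using xw(1) dP(2) P(2) span_minimal by blast
      have "d - x \<in> K"
        unfolding K_def using dP xP P(2) xw by (auto simp: f.diff subspace_diff)
      then have "(d - x) + x \<in> span (D' \<union> C)"
        using xw(1) C(3) by (intro span_add) (auto intro: subsetD[OF span_mono])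
      moreover have "D' \<union> C \<subseteq> B - {d}" using insert D by auto
      ultimately have "d \<in> span (B - {d})"
        by (metis diff_add_cancel span_mono subsetD)
      then show False using B(3) insert.prems D(3) unfolding dependent_def by blast
    qed
    moreover from this have "\<phi> d \<notin> \<phi> ` D' \<union> E"
      using span_superset[of "\<phi> ` D' \<union> E"] by blast
    moreover have "finite (\<phi> ` D' \<union> E)" using insert.hyps(1) E(1) by simp
    moreover have "\<phi> ` insert d D' \<union> E = insert (\<phi> d) (\<phi> ` D' \<union> E)" by simp
    ultimately show ?case
      using insert.IH insert.prems insert.hyps by (simp add: independent_insertI)
  qed
  from this[OF order_refl]
  have ind: "independent (\<phi> ` D \<union> E)" "card (\<phi> ` D \<union> E) = card D + card E"
    by blast+
  have "\<phi> ` C \<subseteq> span E" using C(3) E(3) span_superset[of C] unfolding K_def by auto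
  have "\<phi> ` P \<union> W \<subseteq> span (\<phi> ` D \<union> E)"
  proof (intro Un_least)
    have "\<phi> ` B = \<phi> ` D \<union> \<phi> ` C" using D(3) by (metis image_Un)
    moreover have "\<phi> ` C \<subseteq> span (\<phi> ` D \<union> E)"
      by (rule order_trans[OF \<open>\<phi> ` C \<subseteq> span E\<close>]) (simp add: span_mono)
    moreover have "\<phi> ` D \<subseteq> span (\<phi> ` D \<union> E)"
      by (rule order_trans[OF _ span_superset]) simp
    ultimately have "\<phi> ` B \<subseteq> span (\<phi> ` D \<union> E)" by simp
    then show "\<phi> ` P \<subseteq> span (\<phi> ` D \<union> E)"
      using span_minimal[OF _ subspace_span] spB f.span_image by metis
    show "W \<subseteq> span (\<phi> ` D \<union> E)" using E(3) span_mono[of E "\<phi> ` D \<union> E"] by auto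
  qed
  moreover have "\<phi> ` D \<union> E \<subseteq> span (\<phi> ` P \<union> W)"
  proof -
    have "D \<subseteq> P" "E \<subseteq> W" using D(3) B(2) E(3) span_superset[of E] by auto
    then have "\<phi> ` D \<union> E \<subseteq> \<phi> ` P \<union> W" by auto
    then show ?thesis using span_superset by (rule order_trans)
  qed
  ultimately have "span (\<phi> ` P \<union> W) = span (\<phi> ` D \<union> E)"
    by (intro subset_antisym span_minimal subspace_span)
  then have "dim (span (\<phi> ` P \<union> W)) = card D + card E"
    using dim_span_eq_card_independent[OF ind(1)] ind(2) by simp
  moreover have "card B = card D + card C"
    using card_Un_disjoint[OF D(1) C(1) D(2)] D(3) by simp
  ultimately show ?thesis using dimP C(4) E(4) K_def by simp
qed

end

interpretation P: vec_space "\<lambda>(c::'k::field) (f::'k poly3) m. c * f m"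
  by unfold_locales (auto simp: fun_eq_iff algebra_simps)

lemma kdim_eq_dim: "kdim V = P.dim V"
  by (simp add: kdim_def)

section \<open>Multiplication by linear forms\<close>

definition mX :: "'k::field poly3 \<Rightarrow> 'k poly3" where "mX = pmult (var 0)"
definition mY :: "'k::field poly3 \<Rightarrow> 'k poly3" where "mY = pmult (var 1)"
definition mZ :: "'k::field poly3 \<Rightarrow> 'k poly3" where "mZ = pmult (var 2)"

text \<open>Besides the variables this covers the constants \<open>i = j = k = 0\<close>, through
  which an ideal is closed under scalars.\<close>

lemma pmult_single:
  fixes v :: "'k::field"
  shows "pmult (\<lambda>m. if m = (i, j, k) then v else 0) f (a, b, c) =
    (if i \<le> a \<and> j \<le> b \<and> k \<le> c then v * f (a - i, b - j, c - k) else 0)"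
proof -
  let ?e = "\<lambda>a1 a2 a3. if (a1, a2, a3) = (i, j, k) then v else 0"
  have "(\<Sum>a3\<le>c. ?e a1 a2 a3 * f (a - a1, b - a2, c - a3)) =
      (if a2 = j then if a1 = i \<and> k \<le> c then v * f (a - a1, b - a2, c - k) else 0 else 0)" for a1 a2
  proof -
    have "(\<Sum>a3\<le>c. ?e a1 a2 a3 * f (a - a1, b - a2, c - a3)) =
      (\<Sum>a3\<le>c. if a3 = k then if a1 = i \<and> a2 = j then v * f (a - a1, b - a2, c - a3) else 0 else 0)"
      by (intro sum.cong) auto
    then show ?thesis by auto
  qed
  moreover have "(\<Sum>a2\<le>b. if a2 = j then if a1 = i \<and> k \<le> c then v * f (a - a1, b - a2, c - k) else 0 else 0) =
      (if a1 = i then if j \<le> b \<and> k \<le> c then v * f (a - a1, b - j, c - k) else 0 else 0)" for a1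
    by auto
  ultimately show ?thesis
    unfolding pmult_def by auto
qed

lemma mX_apply: "mX f (a, b, c) = (if a = 0 then 0 else f (a - 1, b, c))"
  using pmult_single[of 1 0 0 1 f a b c] by (simp add: mX_def var_def)

lemma mY_apply: "mY f (a, b, c) = (if b = 0 then 0 else f (a, b - 1, c))"
  using pmult_single[of 0 1 0 1 f a b c] by (simp add: mY_def var_def)

lemma mZ_apply: "mZ f (a, b, c) = (if c = 0 then 0 else f (a, b, c - 1))"
  using pmult_single[of 0 0 1 1 f a b c] by (simp add: mZ_def var_def)

lemmas mul_apply = mX_apply mY_apply mZ_apply

text \<open>A one-parameter family on a conic: the other lines meet a fixed l_s where y/z = -(s +
  t), so in distinct points. A generic choice becomes a choice of \<open>t\<close> outside a finite
  set.\<close>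

definition mL :: "'k::field \<Rightarrow> 'k poly3 \<Rightarrow> 'k poly3" where
  "mL t f = (\<lambda>m. mX f m + t * mY f m + t\<^sup>2 * mZ f m)"

lemma mL_apply: "mL t f (a, b, c) = (if a = 0 then 0 else f (a - 1, b, c)) +
    t * (if b = 0 then 0 else f (a, b - 1, c)) + t\<^sup>2 * (if c = 0 then 0 else f (a, b, c - 1))"
  by (simp add: mL_def mul_apply)

lemma poly3_eqI: "(\<And>a b c. f (a, b, c) = g (a, b, c)) \<Longrightarrow> f = (g :: 'k::field poly3)"
  by (auto simp: fun_eq_iff)

lemma linear_mul:
  "Vector_Spaces.linear (\<lambda>(c::'k::field) (f::'k poly3) m. c * f m) (\<lambda>c f m. c * f m) mY"
  "Vector_Spaces.linear (\<lambda>(c::'k::field) (f::'k poly3) m. c * f m) (\<lambda>c f m. c * f m) mZ"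
  "Vector_Spaces.linear (\<lambda>(c::'k::field) (f::'k poly3) m. c * f m) (\<lambda>c f m. c * f m) (mL t)"
  by (unfold_locales; intro poly3_eqI; simp add: mul_apply mL_apply algebra_simps)+

lemma mul_linear_simps:
  "mX (f + g) = mX f + mX g" "mY (f + g) = mY f + mY g" "mZ (f + g) = mZ f + mZ g"
  "mL t (f + g) = mL t f + mL t g" "mL t (f - g) = mL t f - mL t g"
  "mX (\<lambda>m. a * f m) = (\<lambda>m. a * mX f m)" "mY (\<lambda>m. a * f m) = (\<lambda>m. a * mY f m)"
  "mZ (\<lambda>m. a * f m) = (\<lambda>m. a * mZ f m)" "mL t (\<lambda>m. a * f m) = (\<lambda>m. a * mL t f m)"
  "mX 0 = 0" "mY 0 = 0" "mZ 0 = 0" "mL t 0 = 0"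
  by (intro poly3_eqI; simp add: mul_apply mL_apply algebra_simps)+

lemma mul_commute:
  "mX (mL t f) = mL t (mX f)" "mY (mL t f) = mL t (mY f)" "mZ (mL t f) = mL t (mZ f)"
  "mL s (mL t f) = mL t (mL s f)"
  "mY (mX f) = mX (mY f)" "mZ (mX f) = mX (mZ f)" "mZ (mY f) = mY (mZ f)"
  by (intro poly3_eqI; simp add: mul_apply mL_apply algebra_simps)+

lemma R_deg_iff: "f \<in> R_deg n \<longleftrightarrow> (\<forall>a b c. a + b + c \<noteq> n \<longrightarrow> f (a, b, c) = 0)"
  unfolding R_deg_def deg3_def by auto

lemma mul_R_deg:
  assumes "f \<in> R_deg n"
  shows "mX f \<in> R_deg (Suc n)" "mY f \<in> R_deg (Suc n)" "mZ f \<in> R_deg (Suc n)" "mL t f \<in> R_deg (Suc n)"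
  using assms unfolding R_deg_iff mul_apply mL_apply by auto

text \<open>Since x has coefficient 1 in l_t, the product at \<open>(Suc a, b, c)\<close> expresses
  \<open>f (a, b, c)\<close> through coefficients with smaller \<open>b + c\<close>.\<close>

lemma mL_eq_0:
  assumes "mL t f = 0"
  shows "f = 0"
proof -
  have "f (a, b, c) = 0" if "b + c = n" for a b c n
    using that
  proof (induction n arbitrary: a b c rule: less_induct)
    case (less n)
    have "mL t f (Suc a, b, c) = 0" using assms by simp
    then have "f (a, b, c) = - t * (if b = 0 then 0 else f (Suc a, b - 1, c))
        - t\<^sup>2 * (if c = 0 then 0 else f (Suc a, b, c - 1))"
      by (simp add: mL_apply eq_neg_iff_add_eq_0 algebra_simps)
    moreover have "b \<noteq> 0 \<Longrightarrow> f (Suc a, b - 1, c) = 0" using less.prems by (intro less.IH[of "n - 1"]) auto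
    moreover have "c \<noteq> 0 \<Longrightarrow> f (Suc a, b, c - 1) = 0" using less.prems by (intro less.IH[of "n - 1"]) auto
    ultimately show ?case by auto
  qed
  then show ?thesis by (intro poly3_eqI) auto
qed

lemma inj_mL: "inj (mL t)"
proof (rule injI)
  fix f g :: "'a poly3"
  assume "mL t f = mL t g"
  then have "mL t (f - g) = 0"
    by (simp add: mul_linear_simps)
  then show "f = g" using mL_eq_0[of t "f - g"] by simp
qed

lemma inj_mY: "inj mY"
proof (rule injI, rule poly3_eqI)
  fix f g :: "'a poly3" and a b c
  assume "mY f = mY g"
  then show "f (a, b, c) = g (a, b, c)"
    using mY_apply[of f a "Suc b" c] mY_apply[of g a "Suc b" c] by simp
qed

lemma inj_mZ: "inj mZ"
proof (rule injI, rule poly3_eqI)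
  fix f g :: "'a poly3" and a b c
  assume "mZ f = mZ g"
  then show "f (a, b, c) = g (a, b, c)"
    using mZ_apply[of f a b "Suc c"] mZ_apply[of g a b "Suc c"] by simp
qed

section \<open>Forms of a fixed degree\<close>

definition mono3 :: "nat \<times> nat \<times> nat \<Rightarrow> 'k::field poly3" where
  "mono3 m = (\<lambda>m'. if m' = m then 1 else 0)"

definition exps :: "nat \<Rightarrow> (nat \<times> nat \<times> nat) set" where
  "exps n = {m. deg3 m = n}"

lemma finite_exps: "finite (exps n)"
  by (rule finite_subset[of _ "{..n} \<times> {..n} \<times> {..n}"]) (auto simp: exps_def deg3_def)

lemma card_exps_Suc: "card (exps (Suc n)) = card (exps n) + (n + 2)"
proof -
  let ?A = "(\<lambda>(a, b, c). (Suc a, b, c)) ` exps n"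
  let ?B = "(\<lambda>b. (0::nat, b, Suc n - b)) ` {..Suc n}"
  have "exps (Suc n) = ?A \<union> ?B"
  proof (intro set_eqI iffI)
    fix m assume m: "m \<in> exps (Suc n)"
    obtain a b c where abc: "m = (a, b, c)" by (metis prod_cases3)
    show "m \<in> ?A \<union> ?B"
    proof (cases a)
      case 0
      then have "m = (\<lambda>b. (0, b, Suc n - b)) b" "b \<in> {..Suc n}"
        using m abc by (auto simp: exps_def deg3_def)
      then show ?thesis by blast
    next
      case (Suc a')
      then have "m = (\<lambda>(a, b, c). (Suc a, b, c)) (a', b, c)" "(a', b, c) \<in> exps n"
        using m abc by (auto simp: exps_def deg3_def)
      then show ?thesis by blast
    qed
  qed (auto simp: exps_def deg3_def)
  moreover have "card ?A = card (exps n)" by (intro card_image) (auto simp: inj_on_def)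
  moreover have "card ?B = n + 2" by (subst card_image) (auto simp: inj_on_def)
  moreover have "?A \<inter> ?B = {}" by auto
  ultimately show ?thesis by (simp add: card_Un_disjoint finite_exps)
qed

lemma subspace_R_deg: "P.subspace (R_deg n)"
  unfolding P.subspace_def by (auto simp: R_deg_def) (metis add_cancel_right_left)

lemma sum_mono3:
  assumes "f \<in> R_deg n"
  shows "f = (\<Sum>m\<in>exps n. (\<lambda>m'. f m * mono3 m m'))"
proof
  fix m'
  have "(\<Sum>m\<in>exps n. (\<lambda>m'. f m * mono3 m m')) m' = (\<Sum>m\<in>exps n. f m * mono3 m m')"
    by (induction rule: finite_induct[OF finite_exps]) auto
  also have "\<dots> = (\<Sum>m\<in>exps n. if m' = m then f m' else 0)"
    by (intro sum.cong) (auto simp: mono3_def)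
  also have "\<dots> = f m'"
    using assms finite_exps[of n] by (cases m') (auto simp: R_deg_iff exps_def deg3_def)
  finally show "f m' = (\<Sum>m\<in>exps n. (\<lambda>m'. f m * mono3 m m')) m'" by simp
qed

lemma inj_mono3: "inj (mono3 :: _ \<Rightarrow> 'k::field poly3)"
  by (rule injI) (metis mono3_def zero_neq_one)

lemma span_mono3: "P.span (mono3 ` exps n) = (R_deg n :: 'k::field poly3 set)"
proof (rule P.span_subspace[OF _ _ subspace_R_deg])
  show "mono3 ` exps n \<subseteq> (R_deg n :: 'k poly3 set)"
    by (auto simp: R_deg_iff mono3_def exps_def deg3_def)
  show "(R_deg n :: 'k poly3 set) \<subseteq> P.span (mono3 ` exps n)"
  proof
    fix f :: "'k poly3" assume "f \<in> R_deg n"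
    have "(\<Sum>m\<in>exps n. (\<lambda>m'. f m * mono3 m m')) \<in> P.span (mono3 ` exps n)"
      by (intro P.span_sum P.span_scale P.span_base) auto
    then show "f \<in> P.span (mono3 ` exps n)"
      using sum_mono3[OF \<open>f \<in> R_deg n\<close>] by simp
  qed
qed

lemma independent_mono3: "P.independent (mono3 ` exps n :: 'k::field poly3 set)"
proof (rule P.independent_if_scalars_zero)
  show "finite (mono3 ` exps n :: 'k poly3 set)" by (simp add: finite_exps)
  fix u :: "'k poly3 \<Rightarrow> 'k" and x :: "'k poly3"
  assume 0: "(\<Sum>x\<in>mono3 ` exps n. (\<lambda>m. u x * x m)) = 0" and x: "x \<in> mono3 ` exps n"
  obtain m' where m': "m' \<in> exps n" "x = mono3 m'" using x by auto
  have "(\<Sum>x\<in>mono3 ` exps n. (\<lambda>m. u x * x m)) = (\<Sum>m\<in>exps n. (\<lambda>m'. u (mono3 m) * mono3 m m'))"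
    by (subst sum.reindex) (auto intro: inj_on_subset[OF inj_mono3])
  then have "(\<Sum>x\<in>mono3 ` exps n. (\<lambda>m. u x * x m)) m' =
      (\<Sum>m\<in>exps n. (\<lambda>m'. u (mono3 m) * mono3 m m')) m'" by simp
  also have "\<dots> = (\<Sum>m\<in>exps n. u (mono3 m) * mono3 m m')"
    by (induction rule: finite_induct[OF finite_exps]) auto
  also have "\<dots> = (\<Sum>m\<in>exps n. if m' = m then u (mono3 m') else 0)"
    by (intro sum.cong) (auto simp: mono3_def)
  also have "\<dots> = u x" using m' by (simp add: finite_exps)
  finally show "u x = 0" using 0 by simp
qed

lemma dim_R_deg: "P.dim (R_deg n :: 'k::field poly3 set) = card (exps n)"
  unfolding span_mono3[symmetric]
  by (subst P.dim_span_eq_card_independent[OF independent_mono3])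
    (auto intro!: card_image inj_on_subset[OF inj_mono3])

lemma fin_dim_R_deg: "P.fin_dim (R_deg n :: 'k::field poly3 set)"
  unfolding P.fin_dim_def span_mono3[symmetric] using finite_exps by blast

section \<open>Restriction to generic lines\<close>

text \<open>The degree \<open>n\<close> part of the principal ideal of l_t; degree 0 is separate,
  there being no forms of degree -1.\<close>

definition img :: "'k::field \<Rightarrow> nat \<Rightarrow> 'k poly3 set" where
  "img t n = (case n of 0 \<Rightarrow> {0} | Suc m \<Rightarrow> mL t ` R_deg m)"

text \<open>Its codimension in \<open>R_deg n\<close> is that of the restriction of \<open>V\<close>
  to the line l_t = 0. Adding the multiples of l_t avoids quotient spaces.\<close>

definition hsec :: "'k::field \<Rightarrow> nat \<Rightarrow> 'k poly3 set \<Rightarrow> 'k poly3 set" where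
  "hsec t n V = P.span (img t n \<union> V)"

definition colon :: "'k::field \<Rightarrow> 'k poly3 set \<Rightarrow> nat \<Rightarrow> 'k poly3 set" where
  "colon t V n = {u \<in> R_deg n. mL t u \<in> V}"

lemma img_simps: "img t 0 = {0}" "img t (Suc n) = mL t ` R_deg n"
  by (simp_all add: img_def)

lemma img_subset: "img t n \<subseteq> R_deg n"
  by (cases n) (auto simp: img_simps mul_R_deg P.subspace_0[OF subspace_R_deg])

lemma subspace_img: "P.subspace (img t n)"
proof (cases n)
  case (Suc m)
  interpret L: Vector_Spaces.linear "\<lambda>(c::'a) (f::'a poly3) m. c * f m" "\<lambda>c f m. c * f m" "mL t"
    by (rule linear_mul)
  show ?thesis unfolding Suc img_simps by (rule L.subspace_image[OF subspace_R_deg])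
qed (simp add: img_simps)

lemma img_mul:
  assumes "u \<in> img t n"
  shows "mX u \<in> img t (Suc n)" "mY u \<in> img t (Suc n)" "mZ u \<in> img t (Suc n)" "mL s u \<in> img t (Suc n)"
proof -
  consider "u = 0" | w m where "n = Suc m" "w \<in> R_deg m" "u = mL t w"
    using assms by (cases n) (auto simp: img_simps)
  then have "mX u \<in> mL t ` R_deg n \<and> mY u \<in> mL t ` R_deg n \<and> mZ u \<in> mL t ` R_deg n \<and>
    mL s u \<in> mL t ` R_deg n"
  proof cases
    case 1
    have "(0::'a poly3) \<in> R_deg n" by (rule P.subspace_0[OF subspace_R_deg])
    then show ?thesis using 1 by (force simp: mul_linear_simps)
  next
    case 2
    then show ?thesis by (auto simp: mul_commute(1-3) mul_commute(4)[of s t] mul_R_deg)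
  qed
  then show "mX u \<in> img t (Suc n)" "mY u \<in> img t (Suc n)" "mZ u \<in> img t (Suc n)" "mL s u \<in> img t (Suc n)"
    by (simp_all add: img_simps)
qed

lemma hsec_iff:
  assumes "P.subspace V"
  shows "f \<in> hsec t n V \<longleftrightarrow> (\<exists>u\<in>img t n. \<exists>v\<in>V. f = u + v)"
  unfolding hsec_def P.span_Un P.span_eq_iff[THEN iffD2, OF assms]
    P.span_eq_iff[THEN iffD2, OF subspace_img] by blast

lemma subspace_hsec: "P.subspace (hsec t n V)"
  by (simp add: hsec_def)

lemma hsec_superset: "V \<subseteq> hsec t n V" "img t n \<subseteq> hsec t n V"
  unfolding hsec_def using P.span_superset by blast+

lemma hsec_subset: "V \<subseteq> R_deg n \<Longrightarrow> hsec t n V \<subseteq> R_deg n"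
  unfolding hsec_def by (intro P.span_minimal subspace_R_deg Un_least img_subset)

lemma hsec_mono: "V \<subseteq> W \<Longrightarrow> hsec t n V \<subseteq> hsec t n W"
  unfolding hsec_def by (intro P.span_mono) auto

lemma hsec_minimal: "V \<subseteq> hsec t n W \<Longrightarrow> hsec t n V \<subseteq> hsec t n W"
  unfolding hsec_def[of t n V] by (intro P.span_minimal subspace_hsec Un_least hsec_superset)

lemma subspace_colon: "P.subspace V \<Longrightarrow> P.subspace (colon t V n)"
  using subspace_R_deg[where n=n] unfolding colon_def P.subspace_def
  by (auto simp: mul_linear_simps)

lemma colon_subset: "colon t V n \<subseteq> R_deg n"
  by (auto simp: colon_def)

lemma fin_dim_forms: "V \<subseteq> R_deg n \<Longrightarrow> P.fin_dim V"
  using fin_dim_R_deg P.fin_dim_subset by blast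

lemma dim_le_R_deg:
  fixes V :: "'k::field poly3 set"
  shows "V \<subseteq> R_deg n \<Longrightarrow> P.dim V \<le> card (exps n)"
  using P.dim_mono_fin[OF fin_dim_R_deg] dim_R_deg by metis

text \<open>The exact sequence in which l_t maps R/(V : l_t) into R/V with cokernel the restriction
  to the line.\<close>

lemma dim_hsec_colon:
  fixes V :: "'k::field poly3 set"
  assumes "P.subspace V" "V \<subseteq> R_deg (Suc n)"
  shows "P.dim (hsec t (Suc n) V) + P.dim (colon t V n) = card (exps n) + P.dim V"
  unfolding hsec_def colon_def img_simps
  by (rule P.dim_image_sum_preimage[OF linear_mul(3) inj_mL fin_dim_R_deg subspace_R_deg
        fin_dim_forms[OF assms(2)] assms(1), unfolded dim_R_deg])

lemma dim_img_Suc: "P.dim (img t (Suc n)) = card (exps n)"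
proof -
  have "colon t {0} n = {0::'a poly3}"
    using P.subspace_0[OF subspace_R_deg[where n=n]] mL_eq_0[of t]
    by (auto simp: colon_def mul_linear_simps)
  moreover have "hsec t (Suc n) {0} = img t (Suc n)"
    using subspace_img[of t "Suc n"] P.subspace_0[OF subspace_img[of t "Suc n"]]
    by (simp add: hsec_def insert_absorb P.span_eq_iff[THEN iffD2])
  ultimately show ?thesis
    using dim_hsec_colon[of "{0::'a poly3}" n t] P.subspace_0[OF subspace_R_deg[where n="Suc n"]] by simp
qed

section \<open>Binary forms on a line and values at the intersection of two lines\<close>

text \<open>For \<open>degree G \<le> n\<close> this is z^n G(y/z), and
  \<open>homogenize n 1\<close> is z^n. Univariate \<open>G\<close> makes the finiteness of roots
  available.\<close>

definition homogenize :: "nat \<Rightarrow> 'k::field poly \<Rightarrow> 'k poly3" where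
  "homogenize n G = (\<lambda>(a, b, c). if a = 0 \<and> b + c = n then coeff G b else 0)"

lemma homogenize_R_deg: "homogenize n G \<in> R_deg n"
  by (auto simp: homogenize_def R_deg_iff)

lemma homogenize_linear: "homogenize n (G + H) = homogenize n G + homogenize n H" "homogenize n (smult a G) = (\<lambda>m. a * homogenize n G m)"
  "homogenize n 0 = 0"
  by (intro poly3_eqI; simp add: homogenize_def)+

lemma mY_homogenize: "mY (homogenize n G) = homogenize (Suc n) (pCons 0 G)"
  by (intro poly3_eqI) (auto simp: mY_apply homogenize_def coeff_pCons split: nat.splits)

lemma mZ_homogenize: "degree G \<le> n \<Longrightarrow> mZ (homogenize n G) = homogenize (Suc n) G"
  by (intro poly3_eqI) (auto simp: mZ_apply homogenize_def coeff_eq_0)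

lemma homogenize_const: "homogenize n [:a:] = (\<lambda>m. a * homogenize n 1 m)"
  by (intro poly3_eqI) (auto simp: homogenize_def coeff_pCons split: nat.splits)

text \<open>Modulo l_s the variable x becomes -s y - s^2 z, which leaves a form in y and z.\<close>

lemma forms_mod_line:
  fixes f :: "'k::field poly3"
  assumes "f \<in> R_deg n"
  shows "\<exists>G. degree G \<le> n \<and> f - homogenize n G \<in> img s n"
  using assms
proof (induction n arbitrary: f)
  case 0
  have "f - homogenize 0 [:f (0, 0, 0):] = 0"
    using 0 by (intro poly3_eqI) (auto simp: homogenize_def R_deg_iff)
  then show ?case by (intro exI[of _ "[:f (0, 0, 0):]"]) (simp add: img_simps zero_fun_def)
next
  case (Suc n)
  \<comment> \<open>Split \<open>f\<close> into x times \<open>u\<close> and a part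
    \<open>G0\<close> free of x; \<open>u\<close> is reduced by induction.\<close>
  define u where "u = (\<lambda>(a, b, c). f (Suc a, b, c))"
  have u: "u \<in> R_deg n" using Suc.prems by (auto simp: u_def R_deg_iff)
  define G0 where "G0 = (\<Sum>b\<le>Suc n. monom (f (0, b, Suc n - b)) b)"
  have G0: "coeff G0 b = (if b \<le> Suc n then f (0, b, Suc n - b) else 0)" for b
    by (simp add: G0_def coeff_sum)
  have degG0: "degree G0 \<le> Suc n" by (rule degree_le) (simp add: G0)
  have f: "f = mX u + homogenize (Suc n) G0"
    using Suc.prems
    by (intro poly3_eqI) (auto simp: mX_apply u_def homogenize_def G0 R_deg_iff intro!: arg_cong[where f = f])
  obtain H where H: "degree H \<le> n" "u - homogenize n H \<in> img s n"
    using Suc.IH[OF u] by blast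
  let ?w = "u - homogenize n H"
  define G where "G = G0 + smult (- s) (pCons 0 H) + smult (- s\<^sup>2) H"
  have "degree (pCons 0 H) \<le> Suc n" using H(1) degree_pCons_le[of 0 H] by linarith
  then have "degree G \<le> Suc n"
    unfolding G_def using degG0 H(1) by (intro degree_add_le order.trans[OF degree_smult_le]) auto
  moreover have "f - homogenize (Suc n) G = mL s u - (\<lambda>m. s * mY ?w m) - (\<lambda>m. s\<^sup>2 * mZ ?w m)"
    unfolding G_def homogenize_linear mY_homogenize[symmetric] mZ_homogenize[OF H(1), symmetric]
    by (subst f, intro poly3_eqI) (simp add: mL_def mul_apply algebra_simps)
  moreover have "\<dots> \<in> img s (Suc n)"
  proof -
    have "mL s u \<in> img s (Suc n)" using u by (simp add: img_simps)
    moreover have "(\<lambda>m. s * mY ?w m) \<in> img s (Suc n)" "(\<lambda>m. s\<^sup>2 * mZ ?w m) \<in> img s (Suc n)"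
      by (intro P.subspace_scale[OF subspace_img] img_mul H(2))+
    ultimately show ?thesis
      using P.subspace_diff[OF subspace_img] by blast
  qed
  ultimately show ?case by metis
qed

text \<open>The lines \<open>x + s y + s\<^sup>2 z = 0\<close> and \<open>x + t y + t\<^sup>2 z = 0\<close> meet at
  \<open>(s t, -(s + t), 1)\<close>.\<close>

lemma homogenize_mod_two_lines:
  fixes s t :: "'k::field"
  assumes "s \<noteq> t" "degree G \<le> n"
  shows "homogenize n G - (\<lambda>m. poly G (- (s + t)) * homogenize n 1 m) \<in> hsec s n (img t n)"
  using assms(2)
proof (induction n arbitrary: G)
  case 0
  then obtain a where "G = [:a:]" by (metis degree_eq_zeroE le_zero_eq)
  then show ?case
    using P.subspace_0[OF subspace_hsec] by (simp add: homogenize_const zero_fun_def)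
next
  case (Suc n)
  obtain a H where G: "G = pCons a H" by (cases G)
  have H: "degree H \<le> n" using Suc.prems G by (auto simp: degree_pCons_eq_if split: if_splits)
  let ?E = "hsec s (Suc n) (img t (Suc n))"
  let ?p = "- (s + t)"
  let ?u = "homogenize n H"
  let ?w = "homogenize n H - (\<lambda>m. poly H ?p * homogenize n 1 m)"
  have E: "P.subspace ?E" by (rule subspace_hsec)
  have "mL t ?u \<in> ?E" "mL s ?u \<in> ?E"
    using hsec_superset(1)[of "img t (Suc n)" s "Suc n"] hsec_superset(2)[of s "Suc n" "img t (Suc n)"] homogenize_R_deg[of n H] by (auto simp: img_simps)
  \<comment> \<open>(l_t - l_s)/(t - s) = y + (s + t) z, so y acts as \<open>?p\<close> times z
    modulo both lines.\<close>
  then have "(\<lambda>m. inverse (t - s) * (mL t ?u - mL s ?u) m) \<in> ?E"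
    by (intro P.subspace_scale[OF E] P.subspace_diff[OF E])
  moreover have "(\<lambda>m. inverse (t - s) * (mL t ?u - mL s ?u) m) = mY ?u - (\<lambda>m. ?p * mZ ?u m)"
  proof (intro poly3_eqI)
    fix a b c
    have "(mL t ?u - mL s ?u) (a, b, c) =
        (t - s) * ((mY ?u - (\<lambda>m. ?p * mZ ?u m)) (a, b, c))"
      by (simp add: mL_def algebra_simps power2_eq_square)
    then show "inverse (t - s) * (mL t ?u - mL s ?u) (a, b, c) = (mY ?u - (\<lambda>m. ?p * mZ ?u m)) (a, b, c)"
      using assms(1) by (simp del: minus_apply)
  qed
  ultimately have 1: "mY ?u - (\<lambda>m. ?p * mZ ?u m) \<in> ?E" by (simp only:)
  have "?w \<in> hsec s n (img t n)" by (rule Suc.IH[OF H])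
  then obtain v v' where v: "v \<in> img s n" "v' \<in> img t n" "?w = v + v'"
    unfolding hsec_iff[OF subspace_img] by blast
  have "mZ ?w \<in> ?E"
    unfolding v(3) mul_linear_simps hsec_iff[OF subspace_img] using v img_mul by blast
  then have 2: "(\<lambda>m. ?p * mZ ?w m) \<in> ?E" by (rule P.subspace_scale[OF E])
  have Z1: "mZ (homogenize n 1) = homogenize (Suc n) 1" by (rule mZ_homogenize) simp
  \<comment> \<open>Horner step for \<open>pCons a H\<close>: replace y by \<open>?p\<close> times
    z, then \<open>H\<close> by \<open>poly H ?p\<close> times z^n.\<close>
  have "homogenize (Suc n) G = (\<lambda>m. a * homogenize (Suc n) 1 m) + mY ?u"
    unfolding mY_homogenize homogenize_const[symmetric] homogenize_linear(1)[symmetric] G by simp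
  then have "homogenize (Suc n) G - (\<lambda>m. poly G ?p * homogenize (Suc n) 1 m) =
      (mY ?u - (\<lambda>m. ?p * mZ ?u m)) + (\<lambda>m. ?p * mZ ?w m)"
    unfolding G Z1[symmetric]
    by (intro poly3_eqI) (simp add: mZ_apply algebra_simps)
  then show ?case using P.subspace_add[OF E 1 2] by (simp only:)
qed

lemma forms_mod_two_lines:
  assumes "s \<noteq> t" "f \<in> R_deg n" "degree G \<le> n" "f - homogenize n G \<in> img s n"
  shows "f - (\<lambda>m. poly G (- (s + t)) * homogenize n 1 m) \<in> hsec s n (img t n)"
proof -
  have "f - homogenize n G \<in> hsec s n (img t n)" using assms(4) hsec_superset by blast
  from P.subspace_add[OF subspace_hsec this homogenize_mod_two_lines[OF assms(1,3)]]
  show ?thesis by simp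
qed

text \<open>Modulo both lines every form is a multiple of z^n, so at most one dimension is
  missing.\<close>

lemma dim_two_lines:
  fixes s t :: "'k::field"
  assumes "s \<noteq> t"
  shows "card (exps n) \<le> Suc (P.dim (hsec s n (img t n)))"
proof -
  let ?E = "hsec s n (img t n)"
  have fin: "P.fin_dim ?E" by (rule fin_dim_forms[OF hsec_subset[OF img_subset]])
  have "R_deg n \<subseteq> P.span (insert (homogenize n 1) ?E)"
  proof
    fix f :: "'k poly3" assume f: "f \<in> R_deg n"
    obtain G where "degree G \<le> n" "f - homogenize n G \<in> img s n" using forms_mod_line[OF f] by blast
    from forms_mod_two_lines[OF assms f this]
    have "(f - (\<lambda>m. poly G (- (s + t)) * homogenize n 1 m)) + (\<lambda>m. poly G (- (s + t)) * homogenize n 1 m)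
        \<in> P.span (insert (homogenize n 1) ?E)"
      by (intro P.span_add P.span_scale) (auto intro: P.span_base)
    then show "f \<in> P.span (insert (homogenize n 1) ?E)" by simp
  qed
  moreover have "P.fin_dim (P.span (insert (homogenize n 1) ?E))"
    using P.fin_dim_Un[OF fin_dim_forms fin, of "{homogenize n 1}"] homogenize_R_deg by auto
  ultimately have "card (exps n) \<le> P.dim (insert (homogenize n 1) ?E)"
    unfolding dim_R_deg[symmetric, where 'k='k] using P.dim_mono_fin[of "P.span (insert (homogenize n 1) ?E)" "R_deg n"] by simp
  also have "\<dots> \<le> Suc (P.dim ?E)" by (rule P.dim_insert_le[OF fin])
  finally show ?thesis .
qed

text \<open>A form in \<open>V\<close> not divisible by l_s restricts to a nonzero polynomial
  \<open>G\<close> on that line. Unless \<open>t = s\<close> or -(s + t) is a root of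
  \<open>G\<close>, the form is nonzero at the intersection point and supplies the missing
  z^n.\<close>

lemma finite_bad_lines:
  fixes V :: "'k::field poly3 set"
  assumes V: "P.subspace V" "V \<subseteq> R_deg n" "\<not> V \<subseteq> img s n"
  shows "finite {t. hsec s n (hsec t n V) \<noteq> R_deg n}"
proof -
  obtain f where f: "f \<in> V" "f \<notin> img s n" using V(3) by blast
  obtain G where G: "degree G \<le> n" "f - homogenize n G \<in> img s n"
    using forms_mod_line f(1) V(2) by blast
  have "G \<noteq> 0" using G(2) f(2) by (auto simp: homogenize_linear)
  then have "finite ((\<lambda>x. - x - s) ` {x. poly G x = 0})" by (simp add: poly_roots_finite)
  then have "finite (insert s ((\<lambda>x. - x - s) ` {x. poly G x = 0}))" by simp
  moreover have "{t. hsec s n (hsec t n V) \<noteq> R_deg n} \<subseteq> insert s ((\<lambda>x. - x - s) ` {x. poly G x = 0})"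
  proof
    fix t assume t: "t \<in> {t. hsec s n (hsec t n V) \<noteq> R_deg n}"
    show "t \<in> insert s ((\<lambda>x. - x - s) ` {x. poly G x = 0})"
    proof (rule ccontr)
      assume "\<not> ?thesis"
      then have st: "s \<noteq> t" and "poly G (- (s + t)) \<noteq> 0" by (auto simp: image_iff)
      let ?a = "poly G (- (s + t))"
      let ?E = "hsec s n (hsec t n V)"
      have E: "P.subspace ?E" by (rule subspace_hsec)
      have sub: "hsec s n (img t n) \<subseteq> ?E" by (intro hsec_mono hsec_superset)
      have "f \<in> ?E"
        by (rule subsetD[OF hsec_superset(1)], rule subsetD[OF hsec_superset(1) f(1)])
      moreover have "f - (\<lambda>m. ?a * homogenize n 1 m) \<in> ?E"
        using forms_mod_two_lines[OF st _ G] f(1) V(2) sub by blast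
      ultimately have "(\<lambda>m. inverse ?a * (f - (f - (\<lambda>m. ?a * homogenize n 1 m))) m) \<in> ?E"
        by (intro P.subspace_scale[OF E]) (rule P.subspace_diff[OF E])
      moreover have "(\<lambda>m. inverse ?a * (f - (f - (\<lambda>m. ?a * homogenize n 1 m))) m) = homogenize n 1"
        using \<open>?a \<noteq> 0\<close> by (intro poly3_eqI) simp
      ultimately have one: "homogenize n 1 \<in> ?E" by (simp only:)
      have "R_deg n \<subseteq> ?E"
      proof
        fix g :: "'k poly3" assume g: "g \<in> R_deg n"
        obtain H where H: "degree H \<le> n" "g - homogenize n H \<in> img s n" using forms_mod_line[OF g] by blast
        have "(g - (\<lambda>m. poly H (- (s + t)) * homogenize n 1 m)) + (\<lambda>m. poly H (- (s + t)) * homogenize n 1 m) \<in> ?E"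
          using forms_mod_two_lines[OF st g H] sub one
          by (intro P.subspace_add[OF E] P.subspace_scale[OF E]) auto
        then show "g \<in> ?E" by simp
      qed
      then have "?E = R_deg n" using hsec_subset[OF hsec_subset[OF V(2)]] by blast
      then show False using t by simp
    qed
  qed
  ultimately show ?thesis by (rule rev_finite_subset)
qed

section \<open>A lower bound for the codimension\<close>

text \<open>Green's restriction theorem in three variables, by induction on \<open>n\<close>. Write \<open>q\<close> for the
  codimension in the space of forms and \<open>c_t\<close> for the codimension of the restriction to the line
  \<open>l_t = 0\<close>. Then \<open>q(V) = c_s(V) + q(V : l_s)\<close>. Unless \<open>l_s\<close> divides all of \<open>V\<close>, for almost all \<open>t\<close>
  the space \<open>V\<close> does not vanish at the intersection point of the two lines; multiplication by \<open>l_s\<close>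
  then shows \<open>c_t(V : l_s) \<ge> c_t(V)\<close>. If \<open>l_s\<close> divides \<open>V\<close> for all \<open>s\<close>, the inequality loses one, but
  \<open>c_t(V)\<close> is as large as possible.\<close>

lemma codim_lower_bound:
  fixes V :: "'k::field poly3 set"
  assumes "P.subspace V" "V \<subseteq> R_deg n" "infinite T"
    and "\<And>t. t \<in> T \<Longrightarrow> P.dim (hsec t n V) + min c (Suc n) \<le> card (exps n)"
  shows "P.dim V + (\<Sum>j\<le>n. min c (Suc j)) \<le> card (exps n)"
  using assms
proof (induction n arbitrary: V T)
  case 0
  obtain t where "t \<in> T" using 0(3) by (metis finite.emptyI ex_in_conv)
  moreover have "P.dim V \<le> P.dim (hsec t 0 V)"
    by (rule P.dim_mono_fin[OF fin_dim_forms[OF hsec_subset[OF 0(2)]] hsec_superset(1)])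
  ultimately show ?case using 0(4)[of t] by simp
next
  case (Suc n)
  have colon_mono: "P.dim (hsec t n (colon s V n)) \<le> P.dim (colon s (hsec t (Suc n) V) n)" for s t
  proof (rule P.dim_mono_fin[OF fin_dim_forms[OF colon_subset]])
    have "img t n \<subseteq> colon s (hsec t (Suc n) V) n"
      using img_mul(4)[of _ t n s] img_subset[of t n] hsec_superset(2)[of t "Suc n" V]
      by (auto simp: colon_def)
    moreover have "colon s V n \<subseteq> colon s (hsec t (Suc n) V) n"
      using hsec_superset(1)[of V t "Suc n"] by (auto simp: colon_def)
    ultimately show "hsec t n (colon s V n) \<subseteq> colon s (hsec t (Suc n) V) n"
      unfolding hsec_def[of t n] by (intro P.span_minimal subspace_colon subspace_hsec) auto
  qed
  have dims: "P.dim (hsec s (Suc n) (hsec t (Suc n) V)) + P.dim (colon s (hsec t (Suc n) V) n) =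
      card (exps n) + P.dim (hsec t (Suc n) V)" for s t
    by (rule dim_hsec_colon[OF subspace_hsec hsec_subset[OF Suc.prems(2)]])
  have "\<exists>s\<in>T. \<exists>T'. infinite T' \<and> (\<forall>t\<in>T'. P.dim (hsec t n (colon s V n)) + min c (Suc n) \<le> card (exps n))"
  proof (cases "\<exists>s\<in>T. \<not> V \<subseteq> img s (Suc n)")
    case True
    then obtain s where s: "s \<in> T" "\<not> V \<subseteq> img s (Suc n)" by blast
    define T' where "T' = T - {t. hsec s (Suc n) (hsec t (Suc n) V) \<noteq> R_deg (Suc n)}"
    have "infinite T'"
      unfolding T'_def
      using Diff_infinite_finite[OF finite_bad_lines[OF Suc.prems(1,2) s(2)] Suc.prems(3)] .
    moreover have "P.dim (hsec t n (colon s V n)) + min c (Suc n) \<le> card (exps n)" if "t \<in> T'" for t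
      using colon_mono[of t s] dims[of s t] Suc.prems(4)[of t] that unfolding T'_def
      by (auto simp: dim_R_deg)
    ultimately show ?thesis using s(1) by blast
  next
    case False
    obtain s where s: "s \<in> T" using Suc.prems(3) by (metis finite.emptyI ex_in_conv)
    have "P.dim (hsec t n (colon s V n)) + min c (Suc n) \<le> card (exps n)" if t: "t \<in> T - {s}" for t
    proof -
      \<comment> \<open>Divisibility by l_t makes c_t equal to \<open>n + 2\<close>. Restricting
        further to l_s leaves codimension at most one, so the colon has codimension at least
        \<open>n + 1\<close>.\<close>
      have "hsec t (Suc n) V = img t (Suc n)"
        using False t unfolding hsec_def
        by (simp add: Un_absorb2 P.span_eq_iff[THEN iffD2, OF subspace_img])
      moreover have "card (exps (Suc n)) \<le> Suc (P.dim (hsec s (Suc n) (img t (Suc n))))"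
        using t by (intro dim_two_lines) auto
      ultimately show ?thesis
        using colon_mono[of t s] dims[of s t] dim_img_Suc[where n=n and t=t] card_exps_Suc[of n]
        by simp
    qed
    moreover have "infinite (T - {s})" using Suc.prems(3) by simp
    ultimately show ?thesis using s by blast
  qed
  then obtain s T' where s: "s \<in> T" and T': "infinite T'"
    "\<And>t. t \<in> T' \<Longrightarrow> P.dim (hsec t n (colon s V n)) + min c (Suc n) \<le> card (exps n)" by blast
  have "P.dim (colon s V n) + (\<Sum>j\<le>n. min c (Suc j)) \<le> card (exps n)"
    by (rule Suc.IH[OF subspace_colon[OF Suc.prems(1)] colon_subset T'])
  then show ?case
    using dim_hsec_colon[OF Suc.prems(1,2), of s] Suc.prems(4)[OF s] by simp
qed

text \<open>In degree \<open>n + 2\<close> the bounds for c = 2 and c = 3 become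
  \<open>2 * n + 5\<close> and \<open>3 * n + 6\<close>; the second exceeds the value allowed in the
  extremal case.\<close>

lemma sum_min_2: "(\<Sum>j\<le>n. min 2 (Suc j)) = 2 * n + 1"
  by (induction n) auto

lemma sum_min_3: "(\<Sum>j\<le>Suc n. min 3 (Suc j)) = 3 * n + 3"
  by (induction n) auto

section \<open>Graded ideals without socle in two consecutive degrees\<close>

lemma R_deg_Suc_decomp:
  assumes "f \<in> R_deg (Suc n)"
  obtains u v w where "u \<in> R_deg n" "v \<in> R_deg n" "w \<in> R_deg n" "f = mX u + mY v + mZ w"
proof
  \<comment> \<open>Each monomial is assigned to the first variable dividing it.\<close>
  let ?u = "\<lambda>(a, b, c). f (Suc a, b, c)"
  let ?v = "\<lambda>(a, b, c). if a = 0 then f (a, Suc b, c) else 0"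
  let ?w = "\<lambda>(a, b, c). if a = 0 \<and> b = 0 then f (a, b, Suc c) else 0"
  show "?u \<in> R_deg n" "?v \<in> R_deg n" "?w \<in> R_deg n" using assms by (auto simp: R_deg_iff)
  show "f = mX ?u + mY ?v + mZ ?w"
    using assms by (intro poly3_eqI) (auto simp: mul_apply R_deg_iff)
qed

locale graded_ideal =
  fixes I :: "nat \<Rightarrow> 'k::field poly3 set"
  assumes subspace_I: "P.subspace (I n)"
    and I_subset: "I n \<subseteq> R_deg n"
    and mX_I: "u \<in> I n \<Longrightarrow> mX u \<in> I (Suc n)"
    and mY_I: "u \<in> I n \<Longrightarrow> mY u \<in> I (Suc n)"
    and mZ_I: "u \<in> I n \<Longrightarrow> mZ u \<in> I (Suc n)"
begin

definition socle_free :: "nat \<Rightarrow> bool" where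
  "socle_free n \<longleftrightarrow> (\<forall>u\<in>R_deg n. mX u \<in> I (Suc n) \<longrightarrow> mY u \<in> I (Suc n) \<longrightarrow> mZ u \<in> I (Suc n) \<longrightarrow> u \<in> I n)"

text \<open>On the kernel of l_t, x acts as -t y - t^2 z, so y and z alone detect socle elements
  there.\<close>

lemma mX_in_I_of_mL:
  assumes "mL t u \<in> I n" "mY u \<in> I n" "mZ u \<in> I n"
  shows "mX u \<in> I n"
proof -
  have "mX u = mL t u - (\<lambda>m. t * mY u m) - (\<lambda>m. t\<^sup>2 * mZ u m)"
    by (auto simp: mL_def)
  moreover have "\<dots> \<in> I n"
    using assms by (intro P.subspace_diff[OF subspace_I]) (auto intro: P.subspace_scale[OF subspace_I])
  ultimately show ?thesis by simp
qed

lemma mL_I: "u \<in> I n \<Longrightarrow> mL t u \<in> I (Suc n)"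
proof -
  assume u: "u \<in> I n"
  have "mL t u = mX u + (\<lambda>m. t * mY u m) + (\<lambda>m. t\<^sup>2 * mZ u m)"
    by (auto simp: mL_def)
  moreover have "\<dots> \<in> I (Suc n)"
    using u by (intro P.subspace_add[OF subspace_I] mX_I)
      (auto intro: P.subspace_scale[OF subspace_I] mY_I mZ_I)
  ultimately show ?thesis by simp
qed

lemma fin_dim_I: "P.fin_dim (I n)"
  by (rule fin_dim_forms[OF I_subset])

lemma I_subset_colon: "I n \<subseteq> colon t (I (Suc n)) n"
  using mL_I I_subset[of n] by (auto simp: colon_def)

lemma colon_mul:
  assumes "u \<in> colon t (I (Suc n)) n"
  shows "mY u \<in> colon t (I (Suc (Suc n))) (Suc n)" "mZ u \<in> colon t (I (Suc (Suc n))) (Suc n)"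
  using assms mY_I[of "mL t u" "Suc n"] mZ_I[of "mL t u" "Suc n"]
  by (auto simp: colon_def mul_R_deg mul_commute)

text \<open>Rank-nullity for \<open>M\<close>, later y or z, from \<open>P\<close> to
  \<open>Q\<close> modulo the ideal; in the equality case \<open>M\<close> is onto modulo the
  ideal.\<close>

lemma preimage_bound:
  assumes M: "Vector_Spaces.linear (\<lambda>(c::'k) (f::'k poly3) m. c * f m) (\<lambda>c f m. c * f m) M" "inj M"
    and P: "P.subspace P" "P \<subseteq> R_deg n" and Q: "P.subspace Q" "Q \<subseteq> R_deg (Suc n)"
    and "M ` P \<subseteq> Q" "I (Suc n) \<subseteq> Q"
  shows "P.dim P + P.dim (I (Suc n)) \<le> P.dim Q + P.dim {u \<in> P. M u \<in> I (Suc n)}"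
    and "P.dim P + P.dim (I (Suc n)) = P.dim Q + P.dim {u \<in> P. M u \<in> I (Suc n)} \<Longrightarrow>
      Q = P.span (M ` P \<union> I (Suc n))"
proof -
  let ?S = "P.span (M ` P \<union> I (Suc n))"
  have eq: "P.dim ?S + P.dim {u \<in> P. M u \<in> I (Suc n)} = P.dim P + P.dim (I (Suc n))"
    by (rule P.dim_image_sum_preimage[OF M fin_dim_forms[OF P(2)] P(1) fin_dim_I subspace_I])
  have sub: "?S \<subseteq> Q" using assms(7,8) Q(1) by (intro P.span_minimal) auto
  have "P.dim ?S \<le> P.dim Q" by (rule P.dim_mono_fin[OF fin_dim_forms[OF Q(2)] sub])
  then show "P.dim P + P.dim (I (Suc n)) \<le> P.dim Q + P.dim {u \<in> P. M u \<in> I (Suc n)}"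
    using eq by simp
  assume "P.dim P + P.dim (I (Suc n)) = P.dim Q + P.dim {u \<in> P. M u \<in> I (Suc n)}"
  then have "P.dim Q \<le> P.dim ?S" using eq by simp
  from P.subspace_eq_of_dim_le[OF fin_dim_forms[OF Q(2)] P.subspace_span Q(1) sub this]
  show "Q = ?S" by simp
qed

text \<open>With \<open>K_n\<close> the kernel of multiplication by \<open>l_t\<close> on degree \<open>n\<close>, the map
  \<open>u \<mapsto> (y u, z u)\<close> from \<open>K_n\<close> to \<open>K_{n+1} \<oplus> K_{n+1}\<close> is injective as there is no socle in degree
  \<open>n\<close>. If it were bijective, then \<open>K_{n+1}\<close> would be socle: \<open>(v, 0)\<close> and \<open>(0, v)\<close> are values, so
  \<open>y v\<close> and \<open>z v\<close> vanish because \<open>y\<close> and \<open>z\<close> commute.\<close>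

lemma kernel_dim_less:
  fixes t :: 'k and n :: nat
  defines "K \<equiv> colon t (I (Suc n)) n" and "K' \<equiv> colon t (I (Suc (Suc n))) (Suc n)"
  assumes free: "socle_free n" "socle_free (Suc n)"
    and ge: "P.dim (I n) + 2 * P.dim K' \<le> P.dim K + 2 * P.dim (I (Suc n))"
  shows "P.dim K \<le> P.dim (I n)"
proof -
  \<comment> \<open>Modulo \<open>I\<close>, \<open>ge\<close> says that the dimension of
    \<open>K\<close> is at least twice that of \<open>K'\<close>; the goal is that \<open>K\<close>
    vanishes.\<close>
  have K: "P.subspace K" "K \<subseteq> R_deg n" and K': "P.subspace K'" "K' \<subseteq> R_deg (Suc n)"
    unfolding K_def K'_def by (auto intro!: subspace_colon subspace_I) (auto simp: colon_def)
  have IK': "I (Suc n) \<subseteq> K'" unfolding K'_def by (rule I_subset_colon)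
  have mapsY: "mY ` K \<subseteq> K'" and mapsZ: "mZ ` K \<subseteq> K'"
    unfolding K_def K'_def using colon_mul by blast+
  have half: "K' \<subseteq> {v \<in> R_deg (Suc n). N v \<in> I (Suc (Suc n))}"
    if M: "Vector_Spaces.linear (\<lambda>(c::'k) (f::'k poly3) m. c * f m) (\<lambda>c f m. c * f m) M" "inj M"
      and N: "Vector_Spaces.linear (\<lambda>(c::'k) (f::'k poly3) m. c * f m) (\<lambda>c f m. c * f m) N" "inj N"
      and maps: "M ` K \<subseteq> K'" "N ` K \<subseteq> K'"
      and comm: "\<And>u. N (M u) = M (N u)"
      and MI: "\<And>u n. u \<in> I n \<Longrightarrow> M u \<in> I (Suc n)" and NI: "\<And>u n. u \<in> I n \<Longrightarrow> N u \<in> I (Suc n)"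
      and soc: "{u \<in> {u \<in> K. N u \<in> I (Suc n)}. M u \<in> I (Suc n)} \<subseteq> I n"
    for M N
  proof -
    interpret M: Vector_Spaces.linear "\<lambda>(c::'k) (f::'k poly3) m. c * f m" "\<lambda>c f m. c * f m" M by fact
    interpret N: Vector_Spaces.linear "\<lambda>(c::'k) (f::'k poly3) m. c * f m" "\<lambda>c f m. c * f m" N by fact
    let ?K0 = "{u \<in> K. N u \<in> I (Suc n)}"
    have K0: "P.subspace ?K0" "?K0 \<subseteq> R_deg n"
      using K subspace_I[of "Suc n"]
      unfolding P.subspace_def by (auto simp: N.add N.scale N.zero)
    have MK0: "M ` ?K0 \<subseteq> K'" using maps by auto
    have 1: "P.dim K + P.dim (I (Suc n)) \<le> P.dim K' + P.dim ?K0"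
      by (rule preimage_bound(1)[OF N K K' maps(2) IK'])
    have 2: "P.dim ?K0 + P.dim (I (Suc n)) \<le> P.dim K' + P.dim {u \<in> ?K0. M u \<in> I (Suc n)}"
      by (rule preimage_bound(1)[OF M K0 K' MK0 IK'])
    have 3: "P.dim {u \<in> ?K0. M u \<in> I (Suc n)} \<le> P.dim (I n)"
      by (rule P.dim_mono_fin[OF fin_dim_I soc])
    \<comment> \<open>Added up, 1, 2 and 3 give the reverse of \<open>ge\<close>, so 2 is an
      equality: each \<open>v\<close> in \<open>K'\<close> is some \<open>M u\<close> modulo
      \<open>I\<close> with \<open>N u\<close> in \<open>I\<close>, whence \<open>N v\<close> is
      \<open>M (N u)\<close> modulo \<open>I\<close>.\<close>
    have "K' = P.span (M ` ?K0 \<union> I (Suc n))"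
      by (rule preimage_bound(2)[OF M K0 K' MK0 IK']) (use 1 2 3 ge in linarith)
    moreover have "P.span (M ` ?K0 \<union> I (Suc n)) \<subseteq> {v \<in> R_deg (Suc n). N v \<in> I (Suc (Suc n))}"
    proof (rule P.span_minimal)
      show "M ` ?K0 \<union> I (Suc n) \<subseteq> {v \<in> R_deg (Suc n). N v \<in> I (Suc (Suc n))}"
        using MK0 K'(2) I_subset[of "Suc n"] comm MI NI by auto
      show "P.subspace {v \<in> R_deg (Suc n). N v \<in> I (Suc (Suc n))}"
        using subspace_I[of "Suc (Suc n)"] subspace_R_deg[where n="Suc n"]
        unfolding P.subspace_def by (auto simp: N.add N.scale N.zero)
    qed
    ultimately show ?thesis by simp
  qed
  have soc: "u \<in> I n" if "u \<in> K" "mY u \<in> I (Suc n)" "mZ u \<in> I (Suc n)" for u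
    using that free(1) mX_in_I_of_mL[of t u] unfolding K_def colon_def socle_free_def by blast
  have "K' \<subseteq> {v \<in> R_deg (Suc n). mY v \<in> I (Suc (Suc n))}"
    by (rule half[OF linear_mul(2) inj_mZ linear_mul(1) inj_mY mapsZ mapsY])
      (use soc in \<open>auto simp: mul_commute mY_I mZ_I\<close>)
  moreover have "K' \<subseteq> {v \<in> R_deg (Suc n). mZ v \<in> I (Suc (Suc n))}"
    by (rule half[OF linear_mul(1) inj_mY linear_mul(2) inj_mZ mapsY mapsZ])
      (use soc in \<open>auto simp: mul_commute mY_I mZ_I\<close>)
  ultimately have "K' \<subseteq> I (Suc n)"
    using free(2) mX_in_I_of_mL[of t] unfolding K'_def colon_def socle_free_def by blast
  then have "P.dim K' \<le> P.dim (I (Suc n))" by (rule P.dim_mono_fin[OF fin_dim_I])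
  moreover have "K \<subseteq> I n"
  proof
    fix u assume u: "u \<in> K"
    then have "mY u \<in> I (Suc n)" "mZ u \<in> I (Suc n)"
      using mapsY mapsZ \<open>K' \<subseteq> I (Suc n)\<close> by blast+
    then show "u \<in> I n" using soc u by blast
  qed
  ultimately show ?thesis using P.dim_mono_fin[OF fin_dim_I] by blast
qed

lemma hsec_mul:
  assumes "u \<in> hsec t n (I n)"
  shows "mX u \<in> hsec t (Suc n) (I (Suc n))" "mY u \<in> hsec t (Suc n) (I (Suc n))"
    "mZ u \<in> hsec t (Suc n) (I (Suc n))"
proof -
  obtain p q where "p \<in> img t n" "q \<in> I n" "u = p + q"
    using assms unfolding hsec_iff[OF subspace_I] by blast
  then show "mX u \<in> hsec t (Suc n) (I (Suc n))" "mY u \<in> hsec t (Suc n) (I (Suc n))"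
    "mZ u \<in> hsec t (Suc n) (I (Suc n))"
    unfolding hsec_iff[OF subspace_I] using img_mul mX_I mY_I mZ_I
    by (metis mul_linear_simps(1), metis mul_linear_simps(2), metis mul_linear_simps(3))
qed

lemma hsec_Suc_full:
  assumes "hsec t n (I n) = R_deg n"
  shows "hsec t (Suc n) (I (Suc n)) = R_deg (Suc n)"
proof
  show "hsec t (Suc n) (I (Suc n)) \<subseteq> R_deg (Suc n)" by (rule hsec_subset[OF I_subset])
  let ?H = "hsec t (Suc n) (I (Suc n))"
  have *: "mX u \<in> ?H \<and> mY u \<in> ?H \<and> mZ u \<in> ?H" if "u \<in> R_deg n" for u
    using hsec_mul that assms by blast
  show "R_deg (Suc n) \<subseteq> ?H"
  proof
    fix f :: "'k poly3" assume "f \<in> R_deg (Suc n)"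
    then obtain u v w where "u \<in> R_deg n" "v \<in> R_deg n" "w \<in> R_deg n" "f = mX u + mY v + mZ w"
      by (rule R_deg_Suc_decomp)
    then show "f \<in> ?H" using * by (auto intro!: P.subspace_add[OF subspace_hsec])
  qed
qed

section \<open>The Hilbert function of A / l_t A and its effect on the kernels of l_t\<close>

definition codim_sec :: "'k \<Rightarrow> nat \<Rightarrow> nat" where
  "codim_sec t n = card (exps n) - P.dim (hsec t n (I n))"

lemma codim_sec: "P.dim (hsec t n (I n)) + codim_sec t n = card (exps n)"
  using dim_le_R_deg[OF hsec_subset[OF I_subset[of n]], of t] by (simp add: codim_sec_def)

text \<open>After subtracting \<open>P.dim (I n)\<close>, the kernel of l_t on R/I in degree
  \<open>n\<close> has dimension \<open>codim_sec t (Suc n)\<close> + h_n - h_{n+1}.\<close>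

lemma dim_colon: "P.dim (colon t (I (Suc n)) n) + card (exps (Suc n)) =
    codim_sec t (Suc n) + card (exps n) + P.dim (I (Suc n))"
  using dim_hsec_colon[OF subspace_I[of "Suc n"] I_subset, of t] codim_sec[of t "Suc n"] by simp

text \<open>The numerical assumptions say h_n > h_{n+1} = h_{n+2}, so the kernels in degrees
  \<open>n\<close> and \<open>n + 1\<close> have dimensions at least c' + 1 and exactly c. If c' + 1
  were at least 2 c, the first kernel would vanish.\<close>

lemma codim_sec_bound:
  assumes "socle_free n" "socle_free (Suc n)"
    and "card (exps (Suc n)) + P.dim (I n) < card (exps n) + P.dim (I (Suc n))"
    and "card (exps (Suc n)) + P.dim (I (Suc (Suc n))) = card (exps (Suc (Suc n))) + P.dim (I (Suc n))"
  shows "codim_sec t (Suc n) + 2 \<le> 2 * codim_sec t (Suc (Suc n))"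
proof (rule ccontr)
  assume "\<not> ?thesis"
  then have "P.dim (colon t (I (Suc n)) n) \<le> P.dim (I n)"
    using dim_colon[of t n] dim_colon[of t "Suc n"] assms(3,4)
    by (intro kernel_dim_less[OF assms(1,2)]) linarith
  then show False using dim_colon[of t n] assms(3) by linarith
qed

text \<open>With c at most 1 the inequality forces c' = 0 and c = 1, but A / l_t A stays zero once
  it is zero in one degree.\<close>

lemma codim_sec_ge_2:
  assumes "codim_sec t n + 2 \<le> 2 * codim_sec t (Suc n)"
  shows "2 \<le> codim_sec t (Suc n)"
proof (rule ccontr)
  assume "\<not> ?thesis"
  then have "codim_sec t n = 0" and 1: "codim_sec t (Suc n) \<noteq> 0" using assms by auto
  then have "P.dim (R_deg n :: 'k poly3 set) \<le> P.dim (hsec t n (I n))"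
    using codim_sec[of t n] by (simp add: dim_R_deg)
  then have "hsec t n (I n) = R_deg n"
    by (intro P.subspace_eq_of_dim_le[OF fin_dim_R_deg subspace_hsec subspace_R_deg hsec_subset[OF I_subset]])
  then have "hsec t (Suc n) (I (Suc n)) = R_deg (Suc n)" by (rule hsec_Suc_full)
  then show False using 1 by (simp add: codim_sec_def dim_R_deg)
qed

text \<open>By \<open>full\<close>, l_s maps degree \<open>n\<close> of R/(I + l_t) onto degree
  \<open>n + 1\<close>. The source being no larger than the target, l_s is also injective
  there.\<close>

lemma colon_eq_of_generic:
  assumes full: "hsec s (Suc n) (hsec t (Suc n) (I (Suc n))) = R_deg (Suc n)"
    and "codim_sec t n \<le> codim_sec t (Suc n)"
  shows "hsec t n (I n) = colon s (hsec t (Suc n) (I (Suc n))) n"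
proof (rule P.subspace_eq_of_dim_le[OF fin_dim_forms[OF colon_subset] subspace_hsec
      subspace_colon[OF subspace_hsec]])
  show "hsec t n (I n) \<subseteq> colon s (hsec t (Suc n) (I (Suc n))) n"
  proof
    fix u assume u: "u \<in> hsec t n (I n)"
    then obtain p q where "p \<in> img t n" "q \<in> I n" "u = p + q"
      unfolding hsec_iff[OF subspace_I] by blast
    then have "mL s u \<in> hsec t (Suc n) (I (Suc n))"
      unfolding hsec_iff[OF subspace_I] using img_mul(4) mL_I mul_linear_simps(4) by blast
    then show "u \<in> colon s (hsec t (Suc n) (I (Suc n))) n"
      using u hsec_subset[OF I_subset] by (auto simp: colon_def)
  qed
  have "P.dim (hsec s (Suc n) (hsec t (Suc n) (I (Suc n)))) +
      P.dim (colon s (hsec t (Suc n) (I (Suc n))) n) =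
      card (exps n) + P.dim (hsec t (Suc n) (I (Suc n)))"
    by (rule dim_hsec_colon[OF subspace_hsec hsec_subset[OF I_subset]])
  then have "card (exps (Suc n)) + P.dim (colon s (hsec t (Suc n) (I (Suc n))) n) =
      card (exps n) + P.dim (hsec t (Suc n) (I (Suc n)))"
    using full by (simp add: dim_R_deg)
  then show "P.dim (colon s (hsec t (Suc n) (I (Suc n))) n) \<le> P.dim (hsec t n (I n))"
    using assms(2) codim_sec[of t n] codim_sec[of t "Suc n"] by linarith
qed

text \<open>The extremal case, in which \<open>h_{n+2} = 2 n + 5\<close> and almost every line sees codimension two.
  With \<open>V = (I : l_s)\<close> in degree \<open>n + 1\<close>, enlarging \<open>I\<close> in degree \<open>n + 2\<close> by \<open>x V\<close>, \<open>y V\<close>, \<open>z V\<close> does not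
  change the restriction to the other lines. The lower bound then leaves no room for the
  enlargement to be proper, so \<open>V\<close> consists of socle modulo \<open>I\<close>.\<close>

lemma no_socle_free_plateau:
  assumes inf: "infinite (UNIV :: 'k set)"
    and free: "socle_free n" "socle_free (Suc n)"
    and drop: "card (exps (Suc n)) + P.dim (I n) < card (exps n) + P.dim (I (Suc n))"
    and flat: "card (exps (Suc n)) + P.dim (I (Suc (Suc n))) = card (exps (Suc (Suc n))) + P.dim (I (Suc n))"
    and small: "card (exps (Suc (Suc n))) \<le> P.dim (I (Suc (Suc n))) + (2 * n + 5)"
  shows False
proof -
  let ?c = "\<lambda>t. codim_sec t (Suc (Suc n))"
  have c': "codim_sec t (Suc n) + 2 \<le> 2 * ?c t" for t
    by (rule codim_sec_bound[OF free drop flat])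
  then have c2: "2 \<le> ?c t" for t by (rule codim_sec_ge_2)
  have bound2: "P.dim V + (2 * n + 5) \<le> card (exps (Suc (Suc n)))"
    if "P.subspace V" "V \<subseteq> R_deg (Suc (Suc n))" "infinite T"
      "\<And>t. t \<in> T \<Longrightarrow> P.dim (hsec t (Suc (Suc n)) V) + 2 \<le> card (exps (Suc (Suc n)))" for V T
    using codim_lower_bound[OF that(1-3), of 2] that(4) unfolding sum_min_2 by simp
  have "P.dim (I (Suc (Suc n))) + (2 * n + 5) \<le> card (exps (Suc (Suc n)))"
    using c2 codim_sec[of _ "Suc (Suc n)"]
    by (intro bound2[OF subspace_I I_subset inf]) (metis add_le_cancel_left)
  then have h: "card (exps (Suc (Suc n))) = P.dim (I (Suc (Suc n))) + (2 * n + 5)"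
    using small by simp
  define T where "T = {t. ?c t = 2}"
  \<comment> \<open>Otherwise c is at least 3 on infinitely many lines, giving
    \<open>3 * n + 6 \<le> 2 * n + 5\<close>.\<close>
  have "infinite T"
  proof
    assume "finite T"
    then have inf': "infinite (- T)" using inf by (metis finite_compl)
    have "P.dim (hsec t (Suc (Suc n)) (I (Suc (Suc n)))) + min 3 (Suc (Suc (Suc n))) \<le> card (exps (Suc (Suc n)))"
      if "t \<in> - T" for t
      using that c2[of t] codim_sec[of t "Suc (Suc n)"] unfolding T_def by simp
    from codim_lower_bound[OF subspace_I I_subset inf' this]
    show False using h unfolding sum_min_3 by simp
  qed
  then obtain s where s: "?c s = 2" unfolding T_def using not_finite_existsD by force
  define V where "V = colon s (I (Suc (Suc n))) (Suc n)"
  have VR: "V \<subseteq> R_deg (Suc n)" by (simp add: V_def colon_subset)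
  \<comment> \<open>Divisibility by l_s would make c equal to \<open>n + 3\<close> at
    \<open>s\<close>, not 2.\<close>
  have not_img: "\<not> I (Suc (Suc n)) \<subseteq> img s (Suc (Suc n))"
  proof
    assume "I (Suc (Suc n)) \<subseteq> img s (Suc (Suc n))"
    then have "hsec s (Suc (Suc n)) (I (Suc (Suc n))) = img s (Suc (Suc n))"
      unfolding hsec_def by (simp add: Un_absorb2 P.span_eq_iff[THEN iffD2, OF subspace_img])
    then show False
      using s codim_sec[of s "Suc (Suc n)"] dim_img_Suc[of s "Suc n"]
        card_exps_Suc[of "Suc n"] by simp
  qed
  define T' where "T' = T - {t. hsec s (Suc (Suc n)) (hsec t (Suc (Suc n)) (I (Suc (Suc n))))
      \<noteq> R_deg (Suc (Suc n))}"
  have infT': "infinite T'"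
    unfolding T'_def
    by (rule Diff_infinite_finite[OF finite_bad_lines[OF subspace_I I_subset not_img] \<open>infinite T\<close>])
  define W where "W = P.span (I (Suc (Suc n)) \<union> (mX ` V \<union> mY ` V \<union> mZ ` V))"
  have sec: "P.dim (hsec t (Suc (Suc n)) W) + 2 \<le> card (exps (Suc (Suc n)))" if t: "t \<in> T'" for t
  proof -
    let ?H = "hsec t (Suc (Suc n)) (I (Suc (Suc n)))"
    have ct: "?c t = 2" using t unfolding T'_def T_def by simp
    \<comment> \<open>From c' + 2 \<le> 2 c and c = 2 follows c' \<le> c. So whatever l_s sends into
      \<open>I\<close> already lies in \<open>I\<close> plus multiples of l_t.\<close>
    have "hsec t (Suc n) (I (Suc n)) = colon s ?H (Suc n)"
    proof (rule colon_eq_of_generic)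
      show "hsec s (Suc (Suc n)) ?H = R_deg (Suc (Suc n))" using t unfolding T'_def by simp
      show "codim_sec t (Suc n) \<le> ?c t" using c'[of t] ct by simp
    qed
    moreover have "V \<subseteq> colon s ?H (Suc n)"
      unfolding V_def colon_def using hsec_superset(1)[of "I (Suc (Suc n))" t "Suc (Suc n)"] by auto
    ultimately have "mX ` V \<union> mY ` V \<union> mZ ` V \<subseteq> ?H" using hsec_mul by auto
    then have "W \<subseteq> ?H"
      unfolding W_def by (intro P.span_minimal subspace_hsec Un_least hsec_superset(1)) auto
    then have "hsec t (Suc (Suc n)) W \<subseteq> ?H" by (rule hsec_minimal)
    then have "P.dim (hsec t (Suc (Suc n)) W) \<le> P.dim ?H"
      by (rule P.dim_mono_fin[OF fin_dim_forms[OF hsec_subset[OF I_subset]]])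
    then show ?thesis using codim_sec[of t "Suc (Suc n)"] ct by simp
  qed
  have WR: "W \<subseteq> R_deg (Suc (Suc n))"
    unfolding W_def using VR mul_R_deg I_subset
    by (intro P.span_minimal subspace_R_deg Un_least) blast+
  have "P.dim W + (2 * n + 5) \<le> card (exps (Suc (Suc n)))"
    using sec by (intro bound2[OF _ WR infT']) (simp_all add: W_def)
  then have "P.dim W \<le> P.dim (I (Suc (Suc n)))" using h by simp
  moreover have "I (Suc (Suc n)) \<subseteq> W"
    unfolding W_def by (rule order_trans[OF Un_upper1 P.span_superset])
  ultimately have "I (Suc (Suc n)) = W"
    by (intro P.subspace_eq_of_dim_le[OF fin_dim_forms[OF WR] subspace_I]) (simp_all add: W_def)
  moreover have "mX ` V \<union> mY ` V \<union> mZ ` V \<subseteq> W"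
    unfolding W_def by (rule order_trans[OF Un_upper2 P.span_superset])
  ultimately have "mX ` V \<union> mY ` V \<union> mZ ` V \<subseteq> I (Suc (Suc n))" by simp
  then have "V \<subseteq> I (Suc n)"
    using free(2) VR unfolding socle_free_def by blast
  then have "P.dim V \<le> P.dim (I (Suc n))" by (rule P.dim_mono_fin[OF fin_dim_I])
  \<comment> \<open>By \<open>flat\<close>, \<open>V\<close> exceeds \<open>I (Suc n)\<close> by
    exactly c = 2 dimensions.\<close>
  then show False
    using dim_colon[of s "Suc n"] s flat unfolding V_def by linarith
qed

end

section \<open>Level algebras\<close>

lemma R_deg_Polys: "R_deg n \<subseteq> Polys"
proof
  fix f :: "'a poly3" assume "f \<in> R_deg n"
  then have "{m. f m \<noteq> 0} \<subseteq> exps n" by (auto simp: R_deg_def exps_def)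
  then show "f \<in> Polys" unfolding Polys_def using finite_exps finite_subset by blast
qed

lemma var_Polys: "var j \<in> Polys"
  by (auto simp: Polys_def var_def)

lemma homogeneous_ideal_scale:
  fixes J :: "'k::field poly3 set"
  assumes "homogeneous_ideal J" "f \<in> J"
  shows "(\<lambda>m. c * f m) \<in> J"
proof -
  let ?g = "\<lambda>m. if m = (0, 0, 0) then c else 0"
  have "?g \<in> Polys" by (auto simp: Polys_def)
  then have "pmult ?g f \<in> J" using assms unfolding homogeneous_ideal_def by blast
  moreover have "pmult ?g f = (\<lambda>m. c * f m)"
    by (intro poly3_eqI) (simp add: pmult_single)
  ultimately show ?thesis by simp
qed

lemma graded_ideal_pieces:
  fixes J :: "'k::field poly3 set"
  assumes J: "homogeneous_ideal J"
  shows "graded_ideal (\<lambda>n. J \<inter> R_deg n)"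
proof
  fix n
  have J0: "0 \<in> J" and Jadd: "\<And>f g. f \<in> J \<Longrightarrow> g \<in> J \<Longrightarrow> f + g \<in> J"
    using J unfolding homogeneous_ideal_def zero_fun_def plus_fun_def by auto
  have "P.subspace J"
    unfolding P.subspace_def using J0 Jadd homogeneous_ideal_scale[OF J] by blast
  then show "P.subspace (J \<inter> R_deg n)" using subspace_R_deg by (rule P.subspace_inter)
  have var: "pmult (var j) u \<in> J" if "u \<in> J" for u j
    using J that var_Polys unfolding homogeneous_ideal_def by blast
  show "J \<inter> R_deg n \<subseteq> R_deg n" by simp
  fix u assume "u \<in> J \<inter> R_deg n"
  then show "mX u \<in> J \<inter> R_deg (Suc n)" "mY u \<in> J \<inter> R_deg (Suc n)" "mZ u \<in> J \<inter> R_deg (Suc n)"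
    using var mul_R_deg unfolding mX_def mY_def mZ_def by auto
qed

lemma homog_comp_eq_0: "f \<in> R_deg i \<Longrightarrow> i \<noteq> t \<Longrightarrow> homog_comp t f = (\<lambda>m. 0)"
  by (auto simp: homog_comp_def R_deg_def fun_eq_iff)

text \<open>In the last nonzero degree \<open>M\<close> everything is socle, so levelness forces
  \<open>t = M\<close>. As \<open>s \<le> M\<close>, no degree below \<open>s\<close> carries
  socle.\<close>

lemma level_socle_free:
  fixes J :: "'k::field poly3 set"
  assumes "level_ideal J" "\<not> R_deg s \<subseteq> J" "i < s"
  shows "graded_ideal.socle_free (\<lambda>n. J \<inter> R_deg n) i"
proof -
  obtain t where t: "\<And>f. f \<in> Polys \<Longrightarrow> (\<forall>j<3. pmult (var j) f \<in> J) \<Longrightarrow> (\<lambda>m. f m - homog_comp t f m) \<in> J"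
    using assms(1) unfolding level_ideal_def by blast
  have J: "homogeneous_ideal J" "artinian J" using assms(1) unfolding level_ideal_def by auto
  interpret graded_ideal "\<lambda>n. J \<inter> R_deg n" by (rule graded_ideal_pieces[OF J(1)])
  have soc: "f \<in> J" if f: "f \<in> R_deg k" "mX f \<in> J" "mY f \<in> J" "mZ f \<in> J" "k \<noteq> t" for f k
  proof -
    have "\<forall>j<3. pmult (var j) f \<in> J"
      using f(2-4) unfolding mX_def mY_def mZ_def by (auto simp: numeral_3_eq_3 less_Suc_eq numeral_2_eq_2)
    then have "(\<lambda>m. f m - homog_comp t f m) \<in> J" using t f(1) R_deg_Polys by blast
    then show ?thesis using homog_comp_eq_0[OF f(1,5)] by simp
  qed
  obtain N where N: "\<And>k. k \<ge> N \<Longrightarrow> R_deg k \<subseteq> J" using J(2) unfolding artinian_def by blast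
  define M where "M = Max {k. \<not> R_deg k \<subseteq> J}"
  have fin: "finite {k. \<not> R_deg k \<subseteq> J}"
  proof (rule finite_subset[of _ "{..<N}"])
    show "{k. \<not> R_deg k \<subseteq> J} \<subseteq> {..<N}" using N by (metis (mono_tags) lessThan_iff mem_Collect_eq not_le subsetI)
  qed simp
  have M: "\<not> R_deg M \<subseteq> J" using Max_in[OF fin] assms(2) unfolding M_def by blast
  have sM: "s \<le> M" unfolding M_def using fin assms(2) by (intro Max_ge) auto
  have top: "R_deg (Suc M) \<subseteq> J"
  proof (rule ccontr)
    assume "\<not> R_deg (Suc M) \<subseteq> J"
    then have "Suc M \<le> M" unfolding M_def using fin by (intro Max_ge) auto
    then show False by simp
  qed
  have "M = t"
  proof (rule ccontr)
    assume "M \<noteq> t"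
    then have "R_deg M \<subseteq> J" using soc[of _ M] mul_R_deg[of _ M] top by blast
    then show False using M by simp
  qed
  then show ?thesis
    unfolding socle_free_def using soc[of _ i] sM assms(3) by auto
qed

theorem theorem4p1:
  fixes I :: "'k::field_char_0 poly3 set" and s d :: nat
  assumes "homogeneous_ideal I" and "artinian I"
    and "hilb I s \<noteq> 0" and "\<forall>i>s. hilb I i = 0"
    and "d + 1 \<le> s"
    and "hilb I (d - 1) > hilb I d"
    and "hilb I d = hilb I (d + 1)"
    and "hilb I (d + 1) \<le> 2 * d + 3"
  shows "\<not> (\<exists>J :: 'k poly3 set. level_ideal J \<and> hilb J = hilb I)"
proof
  assume "\<exists>J :: 'k poly3 set. level_ideal J \<and> hilb J = hilb I"
  then obtain J :: "'k poly3 set" where J: "level_ideal J" and hJ: "hilb J = hilb I" by blast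
  \<comment> \<open>For \<open>d = 0\<close> truncated subtraction gives \<open>d - 1 = d\<close>,
    against the strict drop.\<close>
  obtain n where d: "d = Suc n" using assms(6) by (cases d) auto
  interpret graded_ideal "\<lambda>n. J \<inter> R_deg n"
    using J unfolding level_ideal_def by (intro graded_ideal_pieces) blast
  have hilb: "hilb J i + P.dim (J \<inter> R_deg i) = card (exps i)" for i
    unfolding hilb_def kdim_eq_dim dim_R_deg using dim_le_R_deg[of "J \<inter> R_deg i" i] by simp
  have "\<not> R_deg s \<subseteq> J"
  proof
    assume "R_deg s \<subseteq> J"
    then have "J \<inter> R_deg s = R_deg s" by blast
    then show False using hilb[of s] hJ assms(3) by (simp add: dim_R_deg)
  qed
  then have free: "socle_free n" "socle_free (Suc n)"
    using assms(5) d by (auto intro!: level_socle_free[OF J])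
  show False
    \<comment> \<open>With \<open>d = Suc n\<close> the bound \<open>2 * d + 3\<close> is
      \<open>2 * n + 5\<close>.\<close>
    by (rule no_socle_free_plateau[OF infinite_UNIV_char_0 free])
      (use hilb[of n] hilb[of "Suc n"] hilb[of "Suc (Suc n)"] hJ assms(6-8) d in simp_all)
qed

end
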